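(* Let $d\ge1$ and let $f\in C^2(0,+\infty)$ be a convex function with $f(1)=0$ and $f'(1)=0$. Then the following two conditions are equivalent. (A) There exists $\alpha>0$ such that for all $0<x<1<y$, $$\bigl(f'(y)-f'(x)\bigr)^2\ge\alpha\Bigl(\frac1x-\frac1y\Bigr)\Bigl(\frac{f(x)}{1-x}-\frac{f(y)}{1-y}\Bigr).$$ (B) (Gradient dominance) There exists a constant $\alpha_f>0$, depending only on $f$, such that $$\int\rho\Bigl(f'\bigl(\tfrac{\rho}{\rho^*}\bigr)-\mathbb E_\rho\bigl[f'\bigl(\tfrac{\rho}{\rho^*}\bigr)\bigr]\Bigr)^2d\theta\ge\alpha_f\,D_f[\rho\Vert\rho^*]$$ for all smooth positive probability densities $\rho$ and $\rho^*$ on $\mathbb R^d$ such that $f'(\rho/\rho^* )$ is absolutely integrable with respect to $\rho$.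
   Context: $D_f[\rho\Vert\rho^*]=\int\rho^*f(\rho/\rho^* )\,d\theta$ (possibly $+\infty$) and $\mathbb E_\rho[\psi]=\int\rho\,\psi\,d\theta$. Both sides of the inequality in (B) are allowed to take the value $+\infty$. *)

theory Defs
  imports "HOL-Analysis.Analysis"
begin

text \<open>
  The constant in the gradient dominance inequality depends only on \<open>f\<close>, hence not on the
  dimension.  To be able to quantify over the dimension inside a formula, \<open>\<real>\<^sup>d\<close> is
  represented by the functions \<open>nat \<Rightarrow> real\<close> that are extensional on \<open>{..<d}\<close>, with the subspace
  topology of the product topology and with the \<open>d\<close>-fold product of Lebesgue measure, whose space
  is exactly this set.
\<close>

definition Rd :: "nat \<Rightarrow> (nat \<Rightarrow> real) set" where
  "Rd d = (\<Pi>\<^sub>E i\<in>{..<d}. UNIV)"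

definition leb :: "nat \<Rightarrow> (nat \<Rightarrow> real) measure" where
  "leb d = (\<Pi>\<^sub>M i\<in>{..<d}. lborel)"

definition partial_deriv :: "nat \<Rightarrow> ((nat \<Rightarrow> real) \<Rightarrow> real) \<Rightarrow> (nat \<Rightarrow> real) \<Rightarrow> real" where
  "partial_deriv i g x = deriv (\<lambda>t. g (x(i := t))) (x i)"

text \<open>\<open>Ck_on_Rd d k g\<close>: all partial derivatives of \<open>g\<close> of order at most \<open>k\<close> exist and are
  continuous on \<open>\<real>\<^sup>d\<close>.\<close>

primrec Ck_on_Rd :: "nat \<Rightarrow> nat \<Rightarrow> ((nat \<Rightarrow> real) \<Rightarrow> real) \<Rightarrow> bool" where
  "Ck_on_Rd d 0 g \<longleftrightarrow> continuous_on (Rd d) g"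
| "Ck_on_Rd d (Suc k) g \<longleftrightarrow>
     continuous_on (Rd d) g \<and>
     (\<forall>i<d. (\<forall>x\<in>Rd d. (\<lambda>t. g (x(i := t))) differentiable (at (x i))) \<and>
            Ck_on_Rd d k (partial_deriv i g))"

definition smooth_on_Rd :: "nat \<Rightarrow> ((nat \<Rightarrow> real) \<Rightarrow> real) \<Rightarrow> bool" where
  "smooth_on_Rd d g \<longleftrightarrow> (\<forall>k. Ck_on_Rd d k g)"

definition smooth_pos_density :: "nat \<Rightarrow> ((nat \<Rightarrow> real) \<Rightarrow> real) \<Rightarrow> bool" where
  "smooth_pos_density d \<rho> \<longleftrightarrow>
     smooth_on_Rd d \<rho> \<and> (\<forall>\<theta>\<in>Rd d. \<rho> \<theta> > 0) \<and>
     integrable (leb d) \<rho> \<and> (LINT \<theta>|leb d. \<rho> \<theta>) = 1"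

definition expect :: "nat \<Rightarrow> ((nat \<Rightarrow> real) \<Rightarrow> real) \<Rightarrow> ((nat \<Rightarrow> real) \<Rightarrow> real) \<Rightarrow> real" where
  "expect d \<rho> \<psi> = (LINT \<theta>|leb d. \<rho> \<theta> * \<psi> \<theta>)"

text \<open>A convex \<open>f\<close> with \<open>f 1 = 0\<close> and \<open>f' 1 = 0\<close> is nonnegative on \<open>(0,\<infinity>)\<close>, so the truncation
  of negative values by \<^const>\<open>ennreal\<close> has no effect for the functions considered.\<close>

definition f_divergence ::
  "nat \<Rightarrow> (real \<Rightarrow> real) \<Rightarrow> ((nat \<Rightarrow> real) \<Rightarrow> real) \<Rightarrow> ((nat \<Rightarrow> real) \<Rightarrow> real) \<Rightarrow> ennreal" where
  "f_divergence d f \<rho> \<rho>s = (\<integral>\<^sup>+ \<theta>. ennreal (\<rho>s \<theta> * f (\<rho> \<theta> / \<rho>s \<theta>)) \<partial>leb d)"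

definition C2_on_pos :: "(real \<Rightarrow> real) \<Rightarrow> bool" where
  "C2_on_pos f \<longleftrightarrow>
     (\<forall>x>0. f differentiable (at x)) \<and>
     (\<forall>x>0. deriv f differentiable (at x)) \<and>
     continuous_on {0<..} (deriv (deriv f))"

definition two_point_condition :: "(real \<Rightarrow> real) \<Rightarrow> bool" where
  "two_point_condition f \<longleftrightarrow>
     (\<exists>\<alpha>>0. \<forall>x y. 0 < x \<and> x < 1 \<and> 1 < y \<longrightarrow>
        (deriv f y - deriv f x)\<^sup>2 \<ge> \<alpha> * (1 / x - 1 / y) * (f x / (1 - x) - f y / (1 - y)))"

definition gradient_dominance :: "nat \<Rightarrow> (real \<Rightarrow> real) \<Rightarrow> real \<Rightarrow> bool" where
  "gradient_dominance d f \<alpha> \<longleftrightarrow>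
     (\<forall>\<rho> \<rho>s. smooth_pos_density d \<rho> \<and> smooth_pos_density d \<rho>s \<and>
        integrable (leb d) (\<lambda>\<theta>. \<rho> \<theta> * deriv f (\<rho> \<theta> / \<rho>s \<theta>)) \<longrightarrow>
        (\<integral>\<^sup>+ \<theta>. ennreal (\<rho> \<theta> *
            (deriv f (\<rho> \<theta> / \<rho>s \<theta>) - expect d \<rho> (\<lambda>\<eta>. deriv f (\<rho> \<eta> / \<rho>s \<eta>)))\<^sup>2) \<partial>leb d)
          \<ge> ennreal \<alpha> * f_divergence d f \<rho> \<rho>s)"

end

theory Submission
  imports Defs
begin

text \<open>
  Put \<open>r = \<rho>/\<rho>\<^sup>*\<close>, so that \<open>E\<^sub>\<rho>[1/r] = 1\<close> and \<open>D\<^sub>f = E\<^sub>\<rho>[f(r)/r]\<close>. The claim compares the variance of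
  \<open>f'(r)\<close> with \<open>E\<^sub>\<rho>[f(r)/r]\<close> under this single linear constraint.
  By Lagrangian duality, (B) follows from a pointwise inequality
  \<open>(f'(r) - c)\<^sup>2 - \<lambda>(1 - 1/r) \<ge> \<alpha> f(r)/r\<close>, and a multiplier \<open>\<lambda>\<close> exists as soon as every lower
  bound coming from a point \<open>x < 1\<close> is below every upper bound coming from a point \<open>y > 1\<close>;
  by Cauchy--Schwarz this is (A), with the same \<open>\<alpha>\<close>.
  Conversely, (A) for \<open>x, y\<close> is (B) for the law of \<open>r\<close> supported on \<open>{x, y}\<close> with \<open>E[1/r] = 1\<close>.
  This law is a limit of laws coming from smooth densities: \<open>\<rho>\<close> is a product of logistic densities and
  \<open>\<rho>\<^sup>*\<close> is \<open>\<rho>\<close> times a normalised steep sigmoid in the first coordinate.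
\<close>

section \<open>The pointwise Lagrangian inequality\<close>

text \<open>Cauchy-Schwarz in Engel form: the difference of the two sides is a perfect square over
  \<open>p * q * (p + q)\<close>.\<close>

lemma square_div_add_ge:
  fixes u v p q :: real
  assumes "p > 0" "q > 0"
  shows "(u + v)\<^sup>2 / (p + q) \<le> u\<^sup>2 / q + v\<^sup>2 / p"
proof -
  have "u\<^sup>2 / q + v\<^sup>2 / p - (u + v)\<^sup>2 / (p + q) = (u * p - v * q)\<^sup>2 / (p * q * (p + q))"
    using assms by (simp add: divide_simps add_pos_pos less_imp_neq) (simp add: power2_eq_square algebra_simps)
  also have "\<dots> \<ge> 0"
    using assms by simp
  finally show ?thesis by simp
qed

text \<open>The supremum of \<open>g\<close> over \<open>A\<close> separates: any point of
  \<open>B\<close> bounds it, and \<open>A \<noteq> {}\<close> makes it a least upper bound.\<close>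

lemma ex_separating_real:
  fixes g h :: "real \<Rightarrow> real"
  assumes "A \<noteq> {}" "B \<noteq> {}" "\<And>x y. x \<in> A \<Longrightarrow> y \<in> B \<Longrightarrow> g x \<le> h y"
  shows "\<exists>l. (\<forall>x\<in>A. g x \<le> l) \<and> (\<forall>y\<in>B. l \<le> h y)"
proof (intro exI conjI ballI)
  obtain y0 where "y0 \<in> B" using assms(2) by blast
  then have bdd: "bdd_above (g ` A)"
    using assms(3) by (intro bdd_aboveI2[of _ _ "h y0"])
  show "g x \<le> (SUP x\<in>A. g x)" if "x \<in> A" for x
    using that bdd by (rule cSUP_upper)
  show "(SUP x\<in>A. g x) \<le> h y" if "y \<in> B" for y
    using assms that by (intro cSUP_least) auto
qed

text \<open>The factor \<open>1 - 1 / r\<close> is negative for \<open>r < 1\<close> and positive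
  for \<open>r > 1\<close>. Solved for \<open>l\<close>, the inequality is therefore a lower bound
  on \<open>l\<close> at points below 1 and an upper bound at points above 1; at
  \<open>r = 1\<close> it says that a square is nonnegative.\<close>

lemma ex_lagrange_multiplier:
  fixes f g :: "real \<Rightarrow> real"
  assumes two_point: "\<And>x y. 0 < x \<Longrightarrow> x < 1 \<Longrightarrow> 1 < y \<Longrightarrow>
      (g y - g x)\<^sup>2 \<ge> \<alpha> * (1 / x - 1 / y) * (f x / (1 - x) - f y / (1 - y))"
    and "f 1 = 0"
  shows "\<exists>l. \<forall>r>0. \<alpha> * (f r / r) \<le> (g r - c)\<^sup>2 - l * (1 - 1 / r)"
proof -
  have "\<exists>l. (\<forall>x\<in>{0<..<1}. (\<alpha> * (f x / x) - (g x - c)\<^sup>2) / (1 / x - 1) \<le> l) \<and>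
            (\<forall>y\<in>{1<..}. l \<le> ((g y - c)\<^sup>2 - \<alpha> * (f y / y)) / (1 - 1 / y))"
  proof (rule ex_separating_real)
    show "{0<..<1::real} \<noteq> {}" "{1<..} \<noteq> ({}::real set)" by auto
    fix x y :: real
    assume xy: "x \<in> {0<..<1}" "y \<in> {1<..}"
    \<comment> \<open>The distances of \<open>1 / x\<close> and \<open>1 / y\<close> from 1, the
      mean that \<open>1 / r\<close> must have.\<close>
    define p q where "p = 1 / x - 1" and "q = 1 - 1 / y"
    have pq: "p > 0" "q > 0"
      using xy by (auto simp: p_def q_def field_simps)
    have "(g y - g x)\<^sup>2 \<ge> \<alpha> * (p + q) * (f x / (1 - x) - f y / (1 - y))"
      using two_point[of x y] xy by (simp add: p_def q_def)
    moreover have "f x / (1 - x) = f x / x / p"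
      using xy by (simp add: p_def field_simps)
    moreover have "f y / (1 - y) = - (f y / y / q)"
      using xy by (simp add: q_def field_simps)
    ultimately have "\<alpha> * (f x / x / p + f y / y / q) \<le> (g y - g x)\<^sup>2 / (p + q)"
      using pq by (simp add: field_simps)
    \<comment> \<open>The value \<open>c\<close> cancels in the sum of \<open>g y - c\<close> and
      \<open>c - g x\<close>, which is why one two-point condition serves every
      \<open>c\<close>.\<close>
    also have "\<dots> \<le> (g y - c)\<^sup>2 / q + (g x - c)\<^sup>2 / p"
      using square_div_add_ge[OF pq, of "g y - c" "c - g x"] by (simp add: power2_commute)
    finally have "\<alpha> * (f x / x) / p - (g x - c)\<^sup>2 / p \<le> (g y - c)\<^sup>2 / q - \<alpha> * (f y / y) / q"
      by (simp add: algebra_simps)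
    then show "(\<alpha> * (f x / x) - (g x - c)\<^sup>2) / (1 / x - 1)
        \<le> ((g y - c)\<^sup>2 - \<alpha> * (f y / y)) / (1 - 1 / y)"
      unfolding p_def q_def diff_divide_distrib .
  qed
  then obtain l where
    lower: "\<And>x. x \<in> {0<..<1} \<Longrightarrow> (\<alpha> * (f x / x) - (g x - c)\<^sup>2) / (1 / x - 1) \<le> l" and
    upper: "\<And>y. y \<in> {1<..} \<Longrightarrow> l \<le> ((g y - c)\<^sup>2 - \<alpha> * (f y / y)) / (1 - 1 / y)"
    by blast
  have "\<alpha> * (f r / r) \<le> (g r - c)\<^sup>2 - l * (1 - 1 / r)" if "r > 0" for r
  proof -
    consider "r < 1" | "r = 1" | "r > 1" by linarith
    then show ?thesis
    proof cases
      case 1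
      then have "r \<in> {0<..<1}" "1 / r - 1 > 0" using that by simp_all
      with lower[of r] show ?thesis
        by (simp only: pos_divide_le_eq) (simp only: algebra_simps)
    next
      case 2
      then show ?thesis using \<open>f 1 = 0\<close> by simp
    next
      case 3
      then have "r \<in> {1<..}" "1 - 1 / r > 0" by simp_all
      with upper[of r] show ?thesis
        by (simp only: pos_le_divide_eq) (simp only: algebra_simps)
    qed
  qed
  then show ?thesis by blast
qed

section \<open>Gradient dominance from the two-point condition\<close>

text \<open>Nothing is known of \<open>h\<close> outside the half-line, so \<open>h\<close> is first
  cut off by an indicator; on the range of \<open>g\<close> this changes nothing.\<close>

lemma borel_measurable_continuous_on_pos:
  fixes h :: "real \<Rightarrow> real"
  assumes "continuous_on {0<..} h" "g \<in> borel_measurable M" "\<And>x. x \<in> space M \<Longrightarrow> g x > 0"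
  shows "(\<lambda>x. h (g x)) \<in> borel_measurable M"
proof -
  have "(\<lambda>x. indicator {0<..} x *\<^sub>R h x) \<in> borel_measurable borel"
    by (rule borel_measurable_continuous_on_indicator) (use assms in auto)
  from measurable_compose[OF assms(2) this]
  show ?thesis
    by (rule measurable_cong[THEN iffD1, rotated]) (use assms in auto)
qed

lemma space_leb: "space (leb d) = Rd d"
  by (simp add: leb_def Rd_def space_PiM)

text \<open>The multiplier inequality is integrated against \<rho>. Its term in \<open>l\<close>
  becomes \<open>l * (\<rho> - \<rho>s)\<close>, which has integral 0. The dimension never enters,
  so \<alpha> is the same for all \<open>d\<close>.\<close>

lemma gradient_dominance_of_two_point:
  fixes f :: "real \<Rightarrow> real"
  assumes "\<alpha> > 0"
    and two_point: "\<And>x y. 0 < x \<Longrightarrow> x < 1 \<Longrightarrow> 1 < y \<Longrightarrow>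
      (deriv f y - deriv f x)\<^sup>2 \<ge> \<alpha> * (1 / x - 1 / y) * (f x / (1 - x) - f y / (1 - y))"
    and "f 1 = 0"
    and nonneg: "\<And>x. x > 0 \<Longrightarrow> f x \<ge> 0"
    and cont: "continuous_on {0<..} f" "continuous_on {0<..} (deriv f)"
  shows "gradient_dominance d f \<alpha>"
  unfolding gradient_dominance_def
proof (intro allI impI, elim conjE)
  fix \<rho> \<rho>s :: "(nat \<Rightarrow> real) \<Rightarrow> real"
  assume dens: "smooth_pos_density d \<rho>" "smooth_pos_density d \<rho>s"
  define c where "c = expect d \<rho> (\<lambda>\<eta>. deriv f (\<rho> \<eta> / \<rho>s \<eta>))"
  obtain l where l: "\<And>r. r > 0 \<Longrightarrow> \<alpha> * (f r / r) \<le> (deriv f r - c)\<^sup>2 - l * (1 - 1 / r)"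
    using ex_lagrange_multiplier[where g = "deriv f" and c = c, OF two_point \<open>f 1 = 0\<close>] by blast
  have pos: "\<And>\<theta>. \<theta> \<in> space (leb d) \<Longrightarrow> \<rho> \<theta> > 0" "\<And>\<theta>. \<theta> \<in> space (leb d) \<Longrightarrow> \<rho>s \<theta> > 0"
    and int: "integrable (leb d) \<rho>" "integrable (leb d) \<rho>s"
    and one: "(LINT \<theta>|leb d. \<rho> \<theta>) = 1" "(LINT \<theta>|leb d. \<rho>s \<theta>) = 1"
    using dens by (auto simp: smooth_pos_density_def space_leb)
  have [measurable]: "\<rho> \<in> borel_measurable (leb d)" "\<rho>s \<in> borel_measurable (leb d)"
    using int by auto
  have ratio [measurable]: "(\<lambda>\<theta>. \<rho> \<theta> / \<rho>s \<theta>) \<in> borel_measurable (leb d)"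
    by measurable
  have [measurable]: "(\<lambda>\<theta>. f (\<rho> \<theta> / \<rho>s \<theta>)) \<in> borel_measurable (leb d)"
    "(\<lambda>\<theta>. deriv f (\<rho> \<theta> / \<rho>s \<theta>)) \<in> borel_measurable (leb d)"
    using pos by (auto intro!: borel_measurable_continuous_on_pos[OF cont(1) ratio]
        borel_measurable_continuous_on_pos[OF cont(2) ratio])
  define A where "A = (\<lambda>\<theta>. \<rho> \<theta> * (deriv f (\<rho> \<theta> / \<rho>s \<theta>) - c)\<^sup>2)"
  define B where "B = (\<lambda>\<theta>. \<rho>s \<theta> * f (\<rho> \<theta> / \<rho>s \<theta>))"
  have [measurable]: "A \<in> borel_measurable (leb d)" "B \<in> borel_measurable (leb d)"
    unfolding A_def B_def by measurable
  have A_nonneg: "A \<theta> \<ge> 0" and B_nonneg: "B \<theta> \<ge> 0" and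
    BA: "\<alpha> * B \<theta> \<le> A \<theta> - l * (\<rho> \<theta> - \<rho>s \<theta>)" if "\<theta> \<in> space (leb d)" for \<theta>
  proof -
    note p = pos[OF that]
    show "A \<theta> \<ge> 0" "B \<theta> \<ge> 0"
      using p nonneg by (auto simp: A_def B_def intro!: mult_nonneg_nonneg less_imp_le[OF p(1)] less_imp_le[OF p(2)])
    \<comment> \<open>The pointwise inequality at
      \<open>r = \<rho> \<theta> / \<rho>s \<theta>\<close>, multiplied by
      \<open>\<rho> \<theta>\<close>; note that \<open>\<rho> / r = \<rho>s\<close>.\<close>
    have "\<rho> \<theta> * (\<alpha> * (f (\<rho> \<theta> / \<rho>s \<theta>) / (\<rho> \<theta> / \<rho>s \<theta>)))
        \<le> \<rho> \<theta> * ((deriv f (\<rho> \<theta> / \<rho>s \<theta>) - c)\<^sup>2 - l * (1 - 1 / (\<rho> \<theta> / \<rho>s \<theta>)))"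
      using p by (intro mult_left_mono l) auto
    moreover have "\<rho> \<theta> * (\<alpha> * (z / (\<rho> \<theta> / \<rho>s \<theta>))) = \<alpha> * (\<rho>s \<theta> * z)" for z
      using p by simp
    moreover have "\<rho> \<theta> * (z - l * (1 - 1 / (\<rho> \<theta> / \<rho>s \<theta>))) = \<rho> \<theta> * z - l * (\<rho> \<theta> - \<rho>s \<theta>)" for z
      using p by (simp add: field_simps)
    ultimately show "\<alpha> * B \<theta> \<le> A \<theta> - l * (\<rho> \<theta> - \<rho>s \<theta>)"
      by (simp only: A_def B_def)
  qed
  have "ennreal \<alpha> * (\<integral>\<^sup>+ \<theta>. ennreal (B \<theta>) \<partial>leb d) \<le> (\<integral>\<^sup>+ \<theta>. ennreal (A \<theta>) \<partial>leb d)"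
  \<comment> \<open>An infinite right side is trivial. A finite one makes \<open>A\<close>
    integrable, and then \<open>BA\<close> forces the divergence to be finite too, so that real
    integrals can be compared.\<close>
  proof (cases "(\<integral>\<^sup>+ \<theta>. ennreal (A \<theta>) \<partial>leb d) = \<infinity>")
    case False
    then have intA: "integrable (leb d) A"
      by (intro integrableI_nonneg) (auto simp: A_nonneg less_top)
    have intB: "integrable (leb d) (\<lambda>\<theta>. \<alpha> * B \<theta>)"
    proof (rule Bochner_Integration.integrable_bound)
      show "integrable (leb d) (\<lambda>\<theta>. A \<theta> - l * (\<rho> \<theta> - \<rho>s \<theta>))"
        using intA int by auto
      have "\<bar>\<alpha> * B \<theta>\<bar> \<le> \<bar>A \<theta> - l * (\<rho> \<theta> - \<rho>s \<theta>)\<bar>" if "\<theta> \<in> space (leb d)" for \<theta>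
      proof -
        have "\<alpha> * B \<theta> \<ge> 0" using B_nonneg[OF that] \<open>\<alpha> > 0\<close> by simp
        then show ?thesis using BA[OF that] by linarith
      qed
      then show "AE \<theta> in leb d. norm (\<alpha> * B \<theta>) \<le> norm (A \<theta> - l * (\<rho> \<theta> - \<rho>s \<theta>))"
        by (auto intro!: AE_I2)
    qed measurable
    have "(LINT \<theta>|leb d. \<alpha> * B \<theta>) \<le> (LINT \<theta>|leb d. A \<theta> - l * (\<rho> \<theta> - \<rho>s \<theta>))"
      using intA int intB BA by (intro integral_mono) auto
    also have "\<dots> = (LINT \<theta>|leb d. A \<theta>)"
      using intA int one by simp
    finally have le: "(LINT \<theta>|leb d. \<alpha> * B \<theta>) \<le> (LINT \<theta>|leb d. A \<theta>)" .
    have "ennreal \<alpha> * (\<integral>\<^sup>+ \<theta>. ennreal (B \<theta>) \<partial>leb d) = (\<integral>\<^sup>+ \<theta>. ennreal \<alpha> * ennreal (B \<theta>) \<partial>leb d)"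
      by (subst nn_integral_cmult) auto
    also have "\<dots> = (\<integral>\<^sup>+ \<theta>. ennreal (\<alpha> * B \<theta>) \<partial>leb d)"
      using \<open>\<alpha> > 0\<close> B_nonneg by (intro nn_integral_cong) (auto simp: ennreal_mult')
    also have "\<dots> = ennreal (LINT \<theta>|leb d. \<alpha> * B \<theta>)"
      using intB \<open>\<alpha> > 0\<close> B_nonneg by (intro nn_integral_eq_integral) (auto intro!: AE_I2)
    also have "\<dots> \<le> ennreal (LINT \<theta>|leb d. A \<theta>)"
      using le by (rule ennreal_leI)
    also have "\<dots> = (\<integral>\<^sup>+ \<theta>. ennreal (A \<theta>) \<partial>leb d)"
      using intA A_nonneg by (intro nn_integral_eq_integral[symmetric]) (auto intro!: AE_I2)
    finally show ?thesis .
  qed simp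
  then show "ennreal \<alpha> * f_divergence d f \<rho> \<rho>s \<le> (\<integral>\<^sup>+ \<theta>. ennreal (\<rho> \<theta> *
            (deriv f (\<rho> \<theta> / \<rho>s \<theta>) - expect d \<rho> (\<lambda>\<eta>. deriv f (\<rho> \<eta> / \<rho>s \<eta>)))\<^sup>2) \<partial>leb d)"
    unfolding f_divergence_def A_def B_def c_def .
qed

section \<open>Smooth densities built from the logistic function\<close>

definition sigmoid :: "real \<Rightarrow> real" where
  "sigmoid t = 1 / (1 + exp (- t))"

lemma sigmoid_pos: "sigmoid t > 0" and sigmoid_less_1: "sigmoid t < 1"
  by (simp_all add: sigmoid_def add_pos_pos)

lemma DERIV_sigmoid: "(sigmoid has_real_derivative sigmoid t * (1 - sigmoid t)) (at t)"
proof -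
  have "1 + exp (- t) \<noteq> 0"
    by (metis add_pos_pos exp_gt_zero less_irrefl zero_less_one)
  then show ?thesis
    unfolding sigmoid_def[abs_def]
    by (auto intro!: derivative_eq_intros simp: field_simps power2_eq_square)
qed

lemma sigmoid_at_top: "(sigmoid \<longlongrightarrow> 1) at_top"
proof -
  have "((\<lambda>t. 1 / (1 + exp (- t))) \<longlongrightarrow> 1 / (1 + 0 :: real)) at_top"
    by (intro tendsto_intros filterlim_compose[OF exp_at_bot filterlim_uminus_at_bot_at_top]) auto
  then show ?thesis by (simp add: sigmoid_def[abs_def])
qed

lemma sigmoid_minus: "sigmoid (- t) = 1 - sigmoid t"
proof -
  have "1 + exp t \<noteq> 0" "1 + exp (-t) \<noteq> 0"
    by (metis add_pos_pos exp_gt_zero less_irrefl zero_less_one)+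
  then show ?thesis
    by (simp add: sigmoid_def field_simps mult_exp_exp)
qed

lemma sigmoid_at_bot: "(sigmoid \<longlongrightarrow> 0) at_bot"
proof -
  have "((\<lambda>t. 1 - sigmoid (- t)) \<longlongrightarrow> 1 - 1) at_bot"
    by (intro tendsto_intros filterlim_compose[OF sigmoid_at_top filterlim_uminus_at_top_at_bot])
  then show ?thesis by (simp add: sigmoid_minus)
qed

text \<open>Used to place a threshold below which the logistic law has a prescribed mass
  \<open>a\<close>.\<close>

lemma sigmoid_logit:
  assumes "0 < a" "a < 1"
  shows "sigmoid (ln (a / (1 - a))) = a"
  using assms by (simp add: sigmoid_def exp_minus field_simps)

section \<open>Functions of one variable closed under differentiation\<close>

text \<open>Since the derivative of \<open>sigmoid\<close> is a polynomial in
  \<open>sigmoid\<close>, this algebra is closed under \<open>deriv\<close>. Membership thus yields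
  derivatives of every order without computing them.\<close>

inductive_set sigmoid_algebra :: "(real \<Rightarrow> real) set" where
  const: "(\<lambda>t. c) \<in> sigmoid_algebra"
| sigmoid: "(\<lambda>t. sigmoid (c * t + e)) \<in> sigmoid_algebra"
| add: "u \<in> sigmoid_algebra \<Longrightarrow> v \<in> sigmoid_algebra \<Longrightarrow> (\<lambda>t. u t + v t) \<in> sigmoid_algebra"
| mult: "u \<in> sigmoid_algebra \<Longrightarrow> v \<in> sigmoid_algebra \<Longrightarrow> (\<lambda>t. u t * v t) \<in> sigmoid_algebra"

lemma sigmoid_algebra_has_derivative:
  assumes "u \<in> sigmoid_algebra"
  shows "\<exists>u'\<in>sigmoid_algebra. \<forall>t. (u has_real_derivative u' t) (at t)"
  using assms
proof induction
  case (const c)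
  show ?case
    by (rule bexI[of _ "\<lambda>t. 0"]) (auto intro: sigmoid_algebra.const)
next
  case (sigmoid c e)
  show ?case
  \<comment> \<open>The factor \<open>1 - sigmoid\<close> is spelled as a sum with a multiple by -1,
    so that the introduction rules match it literally.\<close>
  proof (rule bexI[of _ "\<lambda>t. c * (sigmoid (c * t + e) * (1 + (-1) * sigmoid (c * t + e)))"])
    show "\<forall>t. ((\<lambda>t. sigmoid (c * t + e)) has_real_derivative
        c * (sigmoid (c * t + e) * (1 + (-1) * sigmoid (c * t + e)))) (at t)"
      by (auto intro!: derivative_eq_intros
          DERIV_cong[OF DERIV_chain2[OF DERIV_sigmoid, of "\<lambda>t. c * t + e" c]])
  qed (intro sigmoid_algebra.intros)
next
  case (add u v)
  then obtain u' v' where "u' \<in> sigmoid_algebra" "v' \<in> sigmoid_algebra"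
    "\<And>t. (u has_real_derivative u' t) (at t)" "\<And>t. (v has_real_derivative v' t) (at t)"
    by blast
  then show ?case
    by (intro bexI[of _ "\<lambda>t. u' t + v' t"]) (auto intro: DERIV_add sigmoid_algebra.intros)
next
  case (mult u v)
  then obtain u' v' where *: "u' \<in> sigmoid_algebra" "v' \<in> sigmoid_algebra"
    "\<And>t. (u has_real_derivative u' t) (at t)" "\<And>t. (v has_real_derivative v' t) (at t)"
    by blast
  show ?case
    by (rule bexI[of _ "\<lambda>t. u' t * v t + v' t * u t"])
      (use * mult.hyps in \<open>auto intro!: DERIV_mult' derivative_eq_intros sigmoid_algebra.intros\<close>)
qed

lemma sigmoid_algebra_differentiable:
  "u \<in> sigmoid_algebra \<Longrightarrow> u differentiable (at t)"
  using sigmoid_algebra_has_derivative real_differentiable_def by blast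

lemma sigmoid_algebra_deriv:
  assumes "u \<in> sigmoid_algebra"
  shows "deriv u \<in> sigmoid_algebra"
proof -
  obtain u' where u': "u' \<in> sigmoid_algebra" "\<And>t. (u has_real_derivative u' t) (at t)"
    using sigmoid_algebra_has_derivative[OF assms] by blast
  then have "deriv u = u'"
    by (auto intro: DERIV_imp_deriv)
  with u' show ?thesis by simp
qed

text \<open>A partial derivative of a product of one-variable factors is again such a product, with
  one factor replaced by its derivative. Hence the induction on \<open>k\<close> must leave the
  factors \<open>u\<close> arbitrary.\<close>

lemma Ck_on_Rd_prod:
  fixes S :: "(real \<Rightarrow> real) set"
  assumes diff: "\<And>u t. u \<in> S \<Longrightarrow> u differentiable (at t)"
    and deriv: "\<And>u. u \<in> S \<Longrightarrow> deriv u \<in> S"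
    and "\<And>j. j < d \<Longrightarrow> u j \<in> S"
  shows "Ck_on_Rd d k (\<lambda>x. \<Prod>j<d. u j (x j))"
  using assms(3)
proof (induction k arbitrary: u)
  case (0 u)
  have "continuous_on UNIV (u j)" if "j < d" for j
    using diff[OF 0[OF that]]
    by (auto simp: continuous_on_eq_continuous_within intro!: differentiable_imp_continuous_within)
  then have "continuous_on (Rd d) (\<lambda>x. u j (x j))" if "j < d" for j
    using that
    by (intro continuous_on_compose2[OF _ continuous_on_subset[OF continuous_on_product_coordinates]]) auto
  then show ?case
    by (auto intro!: continuous_on_prod)
next
  case (Suc k u)
  have split: "(\<Prod>j<d. u j ((x(i := t)) j)) = u i t * (\<Prod>j\<in>{..<d} - {i}. u j (x j))"
    if "i < d" for x i t
    using that by (subst prod.remove[of _ i]) (auto intro!: prod.cong)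
  have pd: "partial_deriv i (\<lambda>x. \<Prod>j<d. u j (x j)) = (\<lambda>x. \<Prod>j<d. (u(i := deriv (u i))) j (x j))"
    if "i < d" for i
  proof
    fix x
    have "partial_deriv i (\<lambda>x. \<Prod>j<d. u j (x j)) x
        = deriv (\<lambda>t. u i t * (\<Prod>j\<in>{..<d} - {i}. u j (x j))) (x i)"
      unfolding partial_deriv_def using split[OF that] by simp
    also have "\<dots> = deriv (u i) (x i) * (\<Prod>j\<in>{..<d} - {i}. u j (x j))"
      using diff[OF Suc.prems[OF that]]
      by (intro DERIV_imp_deriv DERIV_cmult_right)
        (simp add: DERIV_deriv_iff_real_differentiable)
    also have "\<dots> = (\<Prod>j<d. (u(i := deriv (u i))) j (x j))"
      using that by (subst (2) prod.remove[of _ i]) (auto intro!: prod.cong)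
    finally show "partial_deriv i (\<lambda>x. \<Prod>j<d. u j (x j)) x
        = (\<Prod>j<d. (u(i := deriv (u i))) j (x j))" .
  qed
  \<comment> \<open>Both clauses of \<open>Ck_on_Rd\<close> contain continuity, so it is read off
    from the induction hypothesis for the unchanged \<open>u\<close>.\<close>
  have cont: "continuous_on (Rd d) (\<lambda>x. \<Prod>j<d. u j (x j))"
    using Suc.IH[of u] Suc.prems by (cases k) auto
  have "(\<lambda>t. \<Prod>j<d. u j ((x(i := t)) j)) differentiable (at (x i))" if "i < d" for x i
    unfolding split[OF that]
    using diff[OF Suc.prems[OF that]] by (intro differentiable_mult differentiable_const)
  moreover have "Ck_on_Rd d k (partial_deriv i (\<lambda>x. \<Prod>j<d. u j (x j)))" if "i < d" for i
    unfolding pd[OF that] by (rule Suc.IH) (use Suc.prems deriv in auto)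
  ultimately show ?case
    using cont by simp
qed

section \<open>The logistic law on the real line\<close>

text \<open>The derivative of \<open>sigmoid\<close>, which is therefore the distribution
  function.\<close>

definition logistic_density :: "real \<Rightarrow> real" where
  "logistic_density t = sigmoid t * (1 - sigmoid t)"

lemma logistic_density_pos: "logistic_density t > 0"
  using sigmoid_pos[of t] sigmoid_less_1[of t] by (simp add: logistic_density_def)

lemma logistic_density_in_sigmoid_algebra: "logistic_density \<in> sigmoid_algebra"
proof -
  have "(\<lambda>t. sigmoid (1 * t + 0) * (1 + (-1) * sigmoid (1 * t + 0))) \<in> sigmoid_algebra"
    by (intro sigmoid_algebra.intros)
  then show ?thesis by (simp add: logistic_density_def[abs_def])
qed

lemma continuous_on_sigmoid: "continuous_on UNIV sigmoid"
  by (rule DERIV_continuous_on) (auto intro: DERIV_subset DERIV_sigmoid)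

lemma borel_measurable_sigmoid [measurable]: "sigmoid \<in> borel_measurable borel"
  by (intro borel_measurable_continuous_onI continuous_on_sigmoid)

lemma borel_measurable_logistic_density [measurable]: "logistic_density \<in> borel_measurable borel"
  unfolding logistic_density_def[abs_def] by measurable

lemma isCont_sigmoid: "isCont sigmoid t"
  using DERIV_sigmoid by (rule DERIV_isCont)

text \<open>The fundamental theorem of calculus from minus infinity, with antiderivative
  \<open>sigmoid\<close>. The endpoint \<open>b\<close> is extended real, to cover both the total
  mass and the mass below a finite threshold.\<close>

lemma
  assumes "-\<infinity> < b" and lim: "((sigmoid \<circ> real_of_ereal) \<longlongrightarrow> l) (at_left b)"
  shows set_integrable_logistic_density: "set_integrable lborel (einterval (-\<infinity>) b) logistic_density"
    and set_integral_logistic_density: "(LBINT t:einterval (-\<infinity>) b. logistic_density t) = l"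
proof -
  have F: "DERIV sigmoid t :> logistic_density t" for t
    unfolding logistic_density_def by (rule DERIV_sigmoid)
  have C: "isCont logistic_density t" for t
    unfolding logistic_density_def[abs_def] by (intro continuous_intros isCont_sigmoid)
  have N: "AE t in lborel. - \<infinity> < ereal t \<longrightarrow> ereal t < b \<longrightarrow> 0 \<le> logistic_density t"
    using logistic_density_pos by (simp add: less_imp_le)
  have bot: "((sigmoid \<circ> real_of_ereal) \<longlongrightarrow> 0) (at_right (-\<infinity>))"
    using sigmoid_at_bot by (simp add: ereal_tendsto_simps)
  note FTC = interval_integral_FTC_nonneg[OF \<open>-\<infinity> < b\<close> F C N bot lim]
  show "set_integrable lborel (einterval (-\<infinity>) b) logistic_density"
    by (rule FTC(1))
  show "(LBINT t:einterval (-\<infinity>) b. logistic_density t) = l"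
    using FTC(2) \<open>-\<infinity> < b\<close> by (simp add: interval_lebesgue_integral_def)
qed

lemma integrable_logistic_density: "integrable lborel logistic_density"
  and integral_logistic_density: "(LINT t|lborel. logistic_density t) = 1"
proof -
  have "((sigmoid \<circ> real_of_ereal) \<longlongrightarrow> 1) (at_left \<infinity>)"
    using sigmoid_at_top by (simp add: ereal_tendsto_simps)
  from set_integrable_logistic_density[OF _ this] set_integral_logistic_density[OF _ this]
  show "integrable lborel logistic_density" "(LINT t|lborel. logistic_density t) = 1"
    by (simp_all add: set_integrable_def set_lebesgue_integral_def)
qed

lemma integral_logistic_density_lessThan:
  "(LINT t|lborel. logistic_density t * indicator {..<b} t) = sigmoid b"
proof -
  have "((sigmoid \<circ> real_of_ereal) \<longlongrightarrow> sigmoid b) (at_left (ereal b))"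
    using isCont_sigmoid[of b] by (simp add: ereal_tendsto_simps isCont_def filterlim_at_split)
  from set_integral_logistic_density[OF _ this] show ?thesis
    by (simp add: set_lebesgue_integral_def mult.commute)
qed

lemma integrable_logistic_density_mult_bounded:
  assumes [measurable]: "h \<in> borel_measurable borel" and "\<And>t. \<bar>h t\<bar> \<le> (K::real)"
  shows "integrable lborel (\<lambda>t. logistic_density t * h t)"
proof (rule Bochner_Integration.integrable_bound)
  show "integrable lborel (\<lambda>t. K * logistic_density t)"
    using integrable_logistic_density by simp
  have "\<bar>logistic_density t\<bar> * \<bar>h t\<bar> \<le> \<bar>logistic_density t\<bar> * \<bar>K\<bar>" for t
    using assms(2)[of t] by (intro mult_left_mono) auto
  then show "AE t in lborel. norm (logistic_density t * h t) \<le> norm (K * logistic_density t)"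
    by (simp add: abs_mult mult.commute)
qed measurable

text \<open>Dominated convergence to a step function with jump at \<open>b\<close>. The limit is the
  mean of a two-point law with masses \<open>sigmoid b\<close> and
  \<open>1 - sigmoid b\<close>.\<close>

lemma integral_logistic_density_tendsto_step:
  fixes h :: "nat \<Rightarrow> real \<Rightarrow> real"
  assumes [measurable]: "\<And>n. h n \<in> borel_measurable borel" and bound: "\<And>n t. \<bar>h n t\<bar> \<le> K"
    and left: "\<And>t. t < b \<Longrightarrow> (\<lambda>n. h n t) \<longlonglongrightarrow> u"
    and right: "\<And>t. t > b \<Longrightarrow> (\<lambda>n. h n t) \<longlonglongrightarrow> v"
  shows "(\<lambda>n. LINT t|lborel. logistic_density t * h n t) \<longlonglongrightarrow> sigmoid b * u + (1 - sigmoid b) * v"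
proof -
  \<comment> \<open>The limit integrand, arranged so that only the total mass and the mass below
    \<open>b\<close> are needed.\<close>
  define s where "s = (\<lambda>t. v * logistic_density t + (u - v) * (logistic_density t * indicator {..<b} t))"
  have [measurable]: "s \<in> borel_measurable borel" unfolding s_def by measurable
  have "(\<lambda>n. LINT t|lborel. logistic_density t * h n t) \<longlonglongrightarrow> (LINT t|lborel. s t)"
  proof (rule integral_dominated_convergence[where w = "\<lambda>t. K * logistic_density t"])
    show "integrable lborel (\<lambda>t. K * logistic_density t)"
      using integrable_logistic_density by simp
    have lim: "(\<lambda>n. logistic_density t * h n t) \<longlonglongrightarrow> s t" if "t \<noteq> b" for t
    proof (cases "t < b")
      case True
      then have "s t = logistic_density t * u" by (simp add: s_def algebra_simps)
      with left[OF True] show ?thesis by (auto intro: tendsto_mult_left)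
    next
      case False
      then have "s t = logistic_density t * v" by (simp add: s_def algebra_simps)
      with right[of t] False that show ?thesis by (auto intro: tendsto_mult_left)
    qed
    \<comment> \<open>Nothing is assumed about convergence at the jump itself, a null set.\<close>
    show "AE t in lborel. (\<lambda>n. logistic_density t * h n t) \<longlonglongrightarrow> s t"
      using AE_lborel_singleton[of b] by eventually_elim (rule lim)
    have "norm (logistic_density t * h n t) \<le> K * logistic_density t" for n t
      using bound[of n t] logistic_density_pos[of t]
      by (simp add: abs_mult mult.commute)
    then show "\<And>n. AE t in lborel. norm (logistic_density t * h n t) \<le> K * logistic_density t"
      by simp
  qed measurable
  moreover have "(LINT t|lborel. s t) = v + (u - v) * sigmoid b"
    unfolding s_def
    using integrable_logistic_density integrable_real_mult_indicator[OF _ integrable_logistic_density, of "{..<b}"]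
    by (simp add: integral_logistic_density integral_logistic_density_lessThan)
  ultimately show ?thesis by (simp add: algebra_simps)
qed

section \<open>Product densities on \<open>Rd d\<close>\<close>

definition logistic_product :: "nat \<Rightarrow> (nat \<Rightarrow> real) \<Rightarrow> real" where
  "logistic_product d \<theta> = (\<Prod>j<d. logistic_density (\<theta> j))"

lemma logistic_product_pos: "logistic_product d \<theta> > 0"
  unfolding logistic_product_def by (intro prod_pos) (simp add: logistic_density_pos)

text \<open>The weight is absorbed into factor 0, which exists because \<open>d \<ge> 1\<close>. The
  product form is what the smoothness lemma and Fubini act on.\<close>

lemma logistic_product_mult_first:
  assumes "d \<ge> 1"
  shows "logistic_product d \<theta> * h (\<theta> 0)
    = (\<Prod>j<d. (if j = 0 then (\<lambda>t. logistic_density t * h t) else logistic_density) (\<theta> j))"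
proof -
  have "0 \<in> {..<d}" using assms by simp
  then show ?thesis
    unfolding logistic_product_def
    by (subst (1 2) prod.remove[of _ 0]) (auto intro!: prod.cong)
qed

text \<open>By Fubini every factor except the first integrates to 1, which reduces integrals over
  \<open>Rd d\<close> to the line.\<close>

lemma
  assumes "d \<ge> 1" and int: "integrable lborel (\<lambda>t. logistic_density t * h t)"
  shows integrable_logistic_product: "integrable (leb d) (\<lambda>\<theta>. logistic_product d \<theta> * h (\<theta> 0))"
    and integral_logistic_product:
      "(LINT \<theta>|leb d. logistic_product d \<theta> * h (\<theta> 0)) = (LINT t|lborel. logistic_density t * h t)"
proof -
  interpret product_sigma_finite "\<lambda>i::nat. lborel :: real measure"
    by standard
  let ?g = "\<lambda>j::nat. if j = 0 then (\<lambda>t. logistic_density t * h t) else logistic_density"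
  have g: "integrable lborel (?g j)" for j
    using int integrable_logistic_density by simp
  show "integrable (leb d) (\<lambda>\<theta>. logistic_product d \<theta> * h (\<theta> 0))"
    unfolding logistic_product_mult_first[OF \<open>d \<ge> 1\<close>] leb_def
    using g by (intro product_integrable_prod) auto
  have "(LINT \<theta>|leb d. logistic_product d \<theta> * h (\<theta> 0)) = (\<Prod>j<d. integral\<^sup>L lborel (?g j))"
    unfolding logistic_product_mult_first[OF \<open>d \<ge> 1\<close>] leb_def
    using g by (intro product_integral_prod) auto
  also have "\<dots> = (\<Prod>j<d. if j = 0 then (LINT t|lborel. logistic_density t * h t) else 1)"
    by (intro prod.cong) (auto simp: integral_logistic_density)
  also have "\<dots> = (LINT t|lborel. logistic_density t * h t)"
    using \<open>d \<ge> 1\<close> by simp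
  finally show "(LINT \<theta>|leb d. logistic_product d \<theta> * h (\<theta> 0))
    = (LINT t|lborel. logistic_density t * h t)" .
qed

lemma smooth_on_Rd_logistic_product:
  assumes "d \<ge> 1" "h \<in> sigmoid_algebra"
  shows "smooth_on_Rd d (\<lambda>\<theta>. logistic_product d \<theta> * h (\<theta> 0))"
  unfolding smooth_on_Rd_def logistic_product_mult_first[OF assms(1)]
  using assms(2)
  by (intro allI Ck_on_Rd_prod[where S = sigmoid_algebra])
    (auto intro: sigmoid_algebra_differentiable sigmoid_algebra_deriv sigmoid_algebra.mult
      logistic_density_in_sigmoid_algebra)

lemma smooth_pos_density_logistic_product:
  assumes "d \<ge> 1" "h \<in> sigmoid_algebra" "\<And>t. h t > 0"
    and "integrable lborel (\<lambda>t. logistic_density t * h t)"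
    and "(LINT t|lborel. logistic_density t * h t) = 1"
  shows "smooth_pos_density d (\<lambda>\<theta>. logistic_product d \<theta> * h (\<theta> 0))"
  unfolding smooth_pos_density_def
  using assms by (auto simp: smooth_on_Rd_logistic_product integrable_logistic_product
      integral_logistic_product logistic_product_pos)

section \<open>The two-point condition from gradient dominance\<close>

lemma sigmoid_algebra_measurable:
  assumes "h \<in> sigmoid_algebra"
  shows "h \<in> borel_measurable borel"
  by (intro borel_measurable_continuous_onI continuous_at_imp_continuous_on ballI
      differentiable_imp_continuous_within sigmoid_algebra_differentiable assms)

lemma logistic_mean_between:
  assumes [measurable]: "h \<in> borel_measurable borel" and b: "\<And>t. m \<le> h t" "\<And>t. h t \<le> M"
  shows "m \<le> (LINT t|lborel. logistic_density t * h t)" "(LINT t|lborel. logistic_density t * h t) \<le> M"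
proof -
  have "\<bar>h t\<bar> \<le> max \<bar>m\<bar> \<bar>M\<bar>" for t
    using b(1)[of t] b(2)[of t] by linarith
  then have int: "integrable lborel (\<lambda>t. logistic_density t * h t)"
    by (intro integrable_logistic_density_mult_bounded) auto
  note pos = less_imp_le[OF logistic_density_pos]
  have "(LINT t|lborel. logistic_density t * m) \<le> (LINT t|lborel. logistic_density t * h t)"
    using int integrable_logistic_density b pos by (intro integral_mono) (auto intro!: mult_left_mono)
  then show "m \<le> (LINT t|lborel. logistic_density t * h t)"
    by (simp add: integral_logistic_density)
  have "(LINT t|lborel. logistic_density t * h t) \<le> (LINT t|lborel. logistic_density t * M)"
    using int integrable_logistic_density b pos by (intro integral_mono) (auto intro!: mult_left_mono)
  then show "(LINT t|lborel. logistic_density t * h t) \<le> M"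
    by (simp add: integral_logistic_density)
qed

lemma continuous_on_pos_bounded:
  fixes h :: "real \<Rightarrow> real"
  assumes "continuous_on {0<..} h" "0 < m"
  obtains K where "\<And>r. m \<le> r \<Longrightarrow> r \<le> M \<Longrightarrow> \<bar>h r\<bar> \<le> K"
proof -
  have "compact (h ` {m..M})"
    using assms by (intro compact_continuous_image) (auto intro: continuous_on_subset)
  then obtain K where "\<forall>z\<in>h ` {m..M}. norm z \<le> K"
    using compact_imp_bounded bounded_iff by blast
  then show ?thesis by (intro that[of K]) auto
qed

text \<open>Gradient dominance is applied to a logistic product \<rho> and to
  \<open>\<rho>s = \<rho> * h / E\<close>, where \<open>E\<close> normalises. Their ratio
  \<open>E / h\<close> depends on the first coordinate only, so all integrals become
  one-dimensional.\<close>

lemma gradient_dominance_logistic: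
  fixes f :: "real \<Rightarrow> real"
  assumes gd: "gradient_dominance d f \<alpha>" and "d \<ge> 1" "\<alpha> > 0"
    and nonneg: "\<And>x. x > 0 \<Longrightarrow> f x \<ge> 0"
    and cont: "continuous_on {0<..} f" "continuous_on {0<..} (deriv f)"
    and h: "h \<in> sigmoid_algebra" "0 < m" "\<And>t. m \<le> h t" "\<And>t. h t \<le> M"
  defines "E \<equiv> LINT t|lborel. logistic_density t * h t"
  defines "c \<equiv> LINT t|lborel. logistic_density t * deriv f (E / h t)"
  shows "\<alpha> * (LINT t|lborel. logistic_density t * (h t / E * f (E / h t)))
    \<le> (LINT t|lborel. logistic_density t * (deriv f (E / h t) - c)\<^sup>2)"
proof -
  note [measurable] = sigmoid_algebra_measurable[OF h(1)]
  have hpos: "h t > 0" for t using h(2) h(3)[of t] by linarith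
  have E: "m \<le> E" "E \<le> M"
    unfolding E_def using h by (auto intro!: logistic_mean_between)
  then have Epos: "E > 0" using h(2) by linarith
  have ratio: "m / M \<le> E / h t" "E / h t \<le> M / m" "E / h t > 0" for t
    using E h(2) h(3)[of t] h(4)[of t] hpos[of t] Epos by (auto intro!: frac_le)
  have quot: "\<bar>h t / E\<bar> \<le> M / m" for t
    using E h(2) h(3)[of t] h(4)[of t] hpos[of t] Epos by (auto intro!: frac_le)
  \<comment> \<open>The ratio stays in a compact subset of the open half-line, where
    \<open>f\<close> and \<open>deriv f\<close> are bounded. This makes all the integrals below
    finite.\<close>
  have "m / M > 0" using E h(2) by auto
  then obtain K K' where K: "\<And>t. \<bar>f (E / h t)\<bar> \<le> K" and K': "\<And>t. \<bar>deriv f (E / h t)\<bar> \<le> K'"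
    using continuous_on_pos_bounded[OF cont(1)] continuous_on_pos_bounded[OF cont(2)] ratio by metis
  have "(\<lambda>t. E / h t) \<in> borel_measurable borel" by measurable
  from borel_measurable_continuous_on_pos[OF cont(1) this ratio(3)]
    borel_measurable_continuous_on_pos[OF cont(2) this ratio(3)]
  have [measurable]: "(\<lambda>t. f (E / h t)) \<in> borel_measurable borel"
    "(\<lambda>t. deriv f (E / h t)) \<in> borel_measurable borel" .
  define \<rho> where "\<rho> = logistic_product d"
  define \<rho>s where "\<rho>s = (\<lambda>\<theta>. logistic_product d \<theta> * (h (\<theta> 0) / E))"
  have r: "\<rho> \<theta> / \<rho>s \<theta> = E / h (\<theta> 0)" for \<theta>
    using logistic_product_pos[of d \<theta>] by (simp add: \<rho>_def \<rho>s_def)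
  \<comment> \<open>The unweighted product is the case of constant weight 1.\<close>
  have "smooth_pos_density d (\<lambda>\<theta>. logistic_product d \<theta> * (\<lambda>t. 1) (\<theta> 0))"
    using \<open>d \<ge> 1\<close>
    by (intro smooth_pos_density_logistic_product)
      (auto simp: integrable_logistic_density integral_logistic_density intro: sigmoid_algebra.const)
  then have dens: "smooth_pos_density d \<rho>"
    by (simp add: \<rho>_def)
  have int_h: "integrable lborel (\<lambda>t. logistic_density t * (h t / E))"
    by (rule integrable_logistic_density_mult_bounded[OF _ quot]) measurable
  have denss: "smooth_pos_density d \<rho>s"
    unfolding \<rho>s_def
  proof (rule smooth_pos_density_logistic_product[of d "\<lambda>t. h t / E"])
    have "(\<lambda>t. h t * (1 / E)) \<in> sigmoid_algebra"
      using h(1) by (intro sigmoid_algebra.intros)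
    then show "(\<lambda>t. h t / E) \<in> sigmoid_algebra" by simp
    show "(LINT t|lborel. logistic_density t * (h t / E)) = 1"
      using Epos by (simp add: E_def[symmetric])
  qed (use int_h hpos Epos \<open>d \<ge> 1\<close> in auto)
  have int_c: "integrable lborel (\<lambda>t. logistic_density t * deriv f (E / h t))"
    by (rule integrable_logistic_density_mult_bounded[OF _ K']) measurable
  have int_var: "integrable lborel (\<lambda>t. logistic_density t * (deriv f (E / h t) - c)\<^sup>2)"
  proof (rule integrable_logistic_density_mult_bounded)
    have "\<bar>deriv f (E / h t) - c\<bar> \<le> K' + \<bar>c\<bar>" for t
      using K'[of t] by linarith
    then show "\<bar>(deriv f (E / h t) - c)\<^sup>2\<bar> \<le> (K' + \<bar>c\<bar>)\<^sup>2" for t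
      using power_mono[of "\<bar>deriv f (E / h t) - c\<bar>" "K' + \<bar>c\<bar>" 2] by simp
  qed measurable
  have int_div: "integrable lborel (\<lambda>t. logistic_density t * (h t / E * f (E / h t)))"
  proof (rule integrable_logistic_density_mult_bounded)
    show "\<bar>h t / E * f (E / h t)\<bar> \<le> M / m * K" for t
      unfolding abs_mult using quot[of t] K[of t] h(2) E by (intro mult_mono) auto
  qed measurable
  have exp: "expect d \<rho> (\<lambda>\<eta>. deriv f (\<rho> \<eta> / \<rho>s \<eta>)) = c"
    unfolding expect_def r unfolding c_def \<rho>_def
    by (rule integral_logistic_product[OF \<open>d \<ge> 1\<close> int_c])
  have "integrable (leb d) (\<lambda>\<theta>. \<rho> \<theta> * deriv f (\<rho> \<theta> / \<rho>s \<theta>))"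
    unfolding r unfolding \<rho>_def by (rule integrable_logistic_product[OF \<open>d \<ge> 1\<close> int_c])
  with gd dens denss have "ennreal \<alpha> * f_divergence d f \<rho> \<rho>s \<le> (\<integral>\<^sup>+ \<theta>. ennreal (\<rho> \<theta> *
      (deriv f (\<rho> \<theta> / \<rho>s \<theta>) - expect d \<rho> (\<lambda>\<eta>. deriv f (\<rho> \<eta> / \<rho>s \<eta>)))\<^sup>2) \<partial>leb d)"
    unfolding gradient_dominance_def by blast
  also have "\<dots> = (\<integral>\<^sup>+ \<theta>. ennreal (\<rho> \<theta> * (deriv f (E / h (\<theta> 0)) - c)\<^sup>2) \<partial>leb d)"
    unfolding exp unfolding r ..
  also have "\<dots> = ennreal (LINT t|lborel. logistic_density t * (deriv f (E / h t) - c)\<^sup>2)"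
    unfolding \<rho>_def
    using integrable_logistic_product[OF \<open>d \<ge> 1\<close> int_var] integral_logistic_product[OF \<open>d \<ge> 1\<close> int_var]
    by (subst nn_integral_eq_integral) (auto intro!: AE_I2 mult_nonneg_nonneg less_imp_le[OF logistic_product_pos])
  also have "f_divergence d f \<rho> \<rho>s
      = (\<integral>\<^sup>+ \<theta>. ennreal (logistic_product d \<theta> * (h (\<theta> 0) / E * f (E / h (\<theta> 0)))) \<partial>leb d)"
    unfolding f_divergence_def r by (simp add: \<rho>s_def mult.assoc)
  also have "\<dots> = ennreal (LINT t|lborel. logistic_density t * (h t / E * f (E / h t)))"
    using integrable_logistic_product[OF \<open>d \<ge> 1\<close> int_div] integral_logistic_product[OF \<open>d \<ge> 1\<close> int_div]
      nonneg[OF ratio(3)] less_imp_le[OF hpos] Epos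
    by (subst nn_integral_eq_integral) (auto intro!: AE_I2 mult_nonneg_nonneg divide_nonneg_pos less_imp_le[OF logistic_product_pos])
  finally show ?thesis
    using \<open>\<alpha> > 0\<close>
    by (simp add: ennreal_mult'[symmetric] ennreal_le_iff integral_nonneg_AE
        less_imp_le[OF logistic_density_pos])
qed

text \<open>The argument is \<open>n * (b - t)\<close>, written in the affine form used by
  \<open>sigmoid_algebra\<close>; the curves steepen to the indicator of
  \<open>t < b\<close>.\<close>

lemma sigmoid_scaled_tendsto:
  shows "t < b \<Longrightarrow> (\<lambda>n. sigmoid (- real n * t + real n * b)) \<longlonglongrightarrow> 1"
    and "t > b \<Longrightarrow> (\<lambda>n. sigmoid (- real n * t + real n * b)) \<longlonglongrightarrow> 0"
proof -
  have eq: "- real n * t + real n * b = (b - t) * real n" for n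
    by (simp add: algebra_simps)
  show "(\<lambda>n. sigmoid (- real n * t + real n * b)) \<longlonglongrightarrow> 1" if "t < b"
    unfolding eq using that
    by (intro filterlim_compose[OF sigmoid_at_top]
        filterlim_tendsto_pos_mult_at_top[OF tendsto_const _ filterlim_real_sequentially]) simp
  show "(\<lambda>n. sigmoid (- real n * t + real n * b)) \<longlonglongrightarrow> 0" if "t > b"
    unfolding eq using that
    by (intro filterlim_compose[OF sigmoid_at_bot]
        filterlim_tendsto_neg_mult_at_bot[OF tendsto_const _ filterlim_real_sequentially]) simp
qed

lemma two_point_of_gradient_dominance:
  fixes f :: "real \<Rightarrow> real"
  assumes gd: "gradient_dominance d f \<alpha>" and "d \<ge> 1" "\<alpha> > 0"
    and nonneg: "\<And>x. x > 0 \<Longrightarrow> f x \<ge> 0"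
    and cont: "continuous_on {0<..} f" "continuous_on {0<..} (deriv f)"
    and xy: "0 < x" "x < 1" "1 < y"
  shows "(deriv f y - deriv f x)\<^sup>2 \<ge> \<alpha> * (1 / x - 1 / y) * (f x / (1 - x) - f y / (1 - y))"
proof -
  define p q where "p = 1 / x - 1" and "q = 1 - 1 / y"
  have pq: "p > 0" "q > 0"
    using xy by (auto simp: p_def q_def field_simps)
  \<comment> \<open>The mass at \<open>x\<close>, solved from
    \<open>a / x + (1 - a) / y = 1\<close>, that is, \<open>a * p = (1 - a) * q\<close>.\<close>
  define a where "a = q / (p + q)"
  have a: "0 < a" "a < 1" "1 - a = p / (p + q)"
    using pq by (auto simp: a_def field_simps)
  \<comment> \<open>The \<open>a\<close>-quantile of the logistic law, at which the step is
    put.\<close>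
  define b where "b = ln (a / (1 - a))"
  have sb: "sigmoid b = a"
    unfolding b_def using a by (intro sigmoid_logit)
  \<comment> \<open>The unnormalised quotient of \<open>\<rho>s\<close> by \<rho>: a smooth step
    from \<open>1 / x\<close> down to \<open>1 / y\<close>, so that its reciprocal steps from
    \<open>x\<close> to \<open>y\<close>.\<close>
  define k where "k = (\<lambda>n t. 1 / y + (1 / x - 1 / y) * sigmoid (- real n * t + real n * b))"
  have k_alg: "k n \<in> sigmoid_algebra" for n
    unfolding k_def by (intro sigmoid_algebra.intros)
  note [measurable] = sigmoid_algebra_measurable[OF k_alg]
  have diff: "1 / x - 1 / y = p + q" "1 / x - 1 / y > 0"
    using pq by (auto simp: p_def q_def)
  have k_lower: "1 / y \<le> k n t" for n t
    unfolding k_def using diff sigmoid_pos[of "- real n * t + real n * b"] by simp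
  have k_upper: "k n t \<le> 1 / x" for n t
  proof -
    have "(1 / x - 1 / y) * sigmoid (- real n * t + real n * b) \<le> 1 / x - 1 / y"
      using diff(2) sigmoid_less_1 less_imp_le by (intro mult_left_le) auto
    then show ?thesis unfolding k_def by linarith
  qed
  have k_pos: "k n t > 0" for n t
    using k_lower[of n t] xy less_le_trans[of 0 "1 / y"] by simp
  have k_left: "(\<lambda>n. k n t) \<longlonglongrightarrow> 1 / x" if "t < b" for t
  proof -
    have "(\<lambda>n. k n t) \<longlonglongrightarrow> 1 / y + (1 / x - 1 / y) * 1"
      unfolding k_def by (intro tendsto_intros sigmoid_scaled_tendsto that)
    then show ?thesis by simp
  qed
  have k_right: "(\<lambda>n. k n t) \<longlonglongrightarrow> 1 / y" if "t > b" for t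
  proof -
    have "(\<lambda>n. k n t) \<longlonglongrightarrow> 1 / y + (1 / x - 1 / y) * 0"
      unfolding k_def by (intro tendsto_intros sigmoid_scaled_tendsto that)
    then show ?thesis by simp
  qed
  \<comment> \<open>The normalising constants need not be 1, but they tend to 1 by the choice of
    \<open>a\<close>; the ratios \<open>r n\<close> thus have the limits \<open>x\<close> and
    \<open>y\<close>.\<close>
  define E where "E = (\<lambda>n. LINT t|lborel. logistic_density t * k n t)"
  have E_bounds: "1 / y \<le> E n" "E n \<le> 1 / x" for n
    unfolding E_def using k_lower k_upper by (auto intro!: logistic_mean_between)
  have E_pos: "E n > 0" for n
    using E_bounds(1)[of n] xy less_le_trans[of 0 "1 / y"] by simp
  have "E \<longlonglongrightarrow> sigmoid b * (1 / x) + (1 - sigmoid b) * (1 / y)"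
    unfolding E_def
  proof (rule integral_logistic_density_tendsto_step[OF _ _ k_left k_right])
    show "\<bar>k n t\<bar> \<le> 1 / x" for n t using k_pos[of n t] k_upper[of n t] by simp
  qed auto
  moreover have "a * (1 / x) + (1 - a) * (1 / y) = 1"
  proof -
    have "a * (1 / x) + (1 - a) * (1 / y) = a * (p + 1) + (1 - a) * (1 - q)"
      by (simp add: p_def q_def)
    also have "\<dots> = 1"
      unfolding a(3) unfolding a_def using pq by (simp add: divide_simps) (simp add: algebra_simps)
    finally show ?thesis .
  qed
  ultimately have E_lim: "E \<longlonglongrightarrow> 1" by (simp add: sb)
  define r where "r = (\<lambda>n t. E n / k n t)"
  have r_meas [measurable]: "r n \<in> borel_measurable borel" for n
    unfolding r_def by measurable
  have r_pos: "r n t > 0" for n t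
    unfolding r_def using E_pos k_pos by simp
  \<comment> \<open>These bounds are uniform in \<open>n\<close>, as dominated convergence
    requires.\<close>
  have r_bounds: "x / y \<le> r n t" "r n t \<le> y / x" for n t
  proof -
    have "(1 / y) / (1 / x) \<le> r n t" "r n t \<le> (1 / x) / (1 / y)"
      unfolding r_def using xy E_bounds[of n] k_lower[of n t] k_upper[of n t] k_pos[of n t] E_pos[of n]
      by (intro frac_le; auto)+
    then show "x / y \<le> r n t" "r n t \<le> y / x" by simp_all
  qed
  have r_left: "(\<lambda>n. r n t) \<longlonglongrightarrow> x" if "t < b" for t
    using tendsto_divide[OF E_lim k_left[OF that]] xy by (simp add: r_def)
  have r_right: "(\<lambda>n. r n t) \<longlonglongrightarrow> y" if "t > b" for t
    using tendsto_divide[OF E_lim k_right[OF that]] xy by (simp add: r_def)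
  have comp: "(\<lambda>n. g (r n t)) \<longlonglongrightarrow> g z"
    if "(\<lambda>n. r n t) \<longlonglongrightarrow> z" "z > 0" "continuous_on {0<..} g" for g :: "real \<Rightarrow> real" and z t
    using that r_pos by (intro continuous_on_tendsto_compose[OF that(3,1)]) auto
  have "x / y > 0" using xy by simp
  then obtain K K' where K: "\<And>n t. \<bar>f (r n t)\<bar> \<le> K" and K': "\<And>n t. \<bar>deriv f (r n t)\<bar> \<le> K'"
    using continuous_on_pos_bounded[OF cont(1)] continuous_on_pos_bounded[OF cont(2)] r_bounds by metis
  have [measurable]: "(\<lambda>t. f (r n t)) \<in> borel_measurable borel"
    "(\<lambda>t. deriv f (r n t)) \<in> borel_measurable borel" for n
    by (fact borel_measurable_continuous_on_pos[OF cont(1) r_meas r_pos]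
        borel_measurable_continuous_on_pos[OF cont(2) r_meas r_pos])+
  define c where "c = (\<lambda>n. LINT t|lborel. logistic_density t * deriv f (r n t))"
  \<comment> \<open>The mean of \<open>deriv f\<close> under the two-point law. The centres
    \<open>c n\<close> vary with \<open>n\<close>, so their convergence has to precede that of the
    variances.\<close>
  define c' where "c' = a * deriv f x + (1 - a) * deriv f y"
  have "c \<longlonglongrightarrow> sigmoid b * deriv f x + (1 - sigmoid b) * deriv f y"
    unfolding c_def
    by (rule integral_logistic_density_tendsto_step[OF _ K'])
      (use cont xy in \<open>auto intro!: comp r_left r_right\<close>)
  then have c_lim: "c \<longlonglongrightarrow> c'" by (simp add: c'_def sb)
  have c_bound: "\<bar>c n\<bar> \<le> K'" for n
  proof -
    have "- K' \<le> deriv f (r n t)" "deriv f (r n t) \<le> K'" for t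
      using K'[of n t] by linarith+
    then have "- K' \<le> c n" "c n \<le> K'"
      unfolding c_def by (auto intro!: logistic_mean_between)
    then show ?thesis by linarith
  qed
  have lim_var: "(\<lambda>n. LINT t|lborel. logistic_density t * (deriv f (r n t) - c n)\<^sup>2)
      \<longlonglongrightarrow> sigmoid b * (deriv f x - c')\<^sup>2 + (1 - sigmoid b) * (deriv f y - c')\<^sup>2"
  proof (rule integral_logistic_density_tendsto_step)
    have "\<bar>deriv f (r n t) - c n\<bar> \<le> 2 * K'" for n t
      using K'[of n t] c_bound[of n] by linarith
    then show "\<bar>(deriv f (r n t) - c n)\<^sup>2\<bar> \<le> (2 * K')\<^sup>2" for n t
      using power_mono[of "\<bar>deriv f (r n t) - c n\<bar>" "2 * K'" 2] by simp
  qed (use cont xy in \<open>auto intro!: tendsto_intros comp r_left r_right c_lim\<close>)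
  have inv_r: "k n t / E n = 1 / r n t" for n t
    by (simp add: r_def)
  have lim_div: "(\<lambda>n. LINT t|lborel. logistic_density t * (1 / r n t * f (r n t)))
      \<longlonglongrightarrow> sigmoid b * (1 / x * f x) + (1 - sigmoid b) * (1 / y * f y)"
  proof (rule integral_logistic_density_tendsto_step)
    show "\<bar>1 / r n t * f (r n t)\<bar> \<le> (y / x) * K" for n t
    proof -
      have "1 / r n t \<le> 1 / (x / y)"
        using r_bounds(1)[of n t] \<open>x / y > 0\<close> by (intro divide_left_mono mult_pos_pos r_pos) auto
      then show ?thesis
        unfolding abs_mult using K[of n t] r_pos[of n t] xy by (intro mult_mono) auto
    qed
  qed (use cont xy in \<open>auto intro!: continuous_intros comp r_left r_right\<close>)
  have "\<alpha> * (LINT t|lborel. logistic_density t * (1 / r n t * f (r n t)))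
      \<le> (LINT t|lborel. logistic_density t * (deriv f (r n t) - c n)\<^sup>2)" for n
    using gradient_dominance_logistic[OF gd \<open>d \<ge> 1\<close> \<open>\<alpha> > 0\<close> nonneg cont k_alg _ k_lower k_upper, of n] xy
    by (simp add: inv_r c_def r_def E_def)
  then have "\<alpha> * (a * (1 / x * f x) + (1 - a) * (1 / y * f y))
      \<le> a * (deriv f x - c')\<^sup>2 + (1 - a) * (deriv f y - c')\<^sup>2"
    unfolding sb[symmetric]
    by (intro LIMSEQ_le[OF tendsto_mult_left[OF lim_div] lim_var]) auto
  \<comment> \<open>The variance of a two-point law.\<close>
  also have "\<dots> = a * (1 - a) * (deriv f y - deriv f x)\<^sup>2"
    unfolding c'_def by (simp add: power2_eq_square algebra_simps)
  \<comment> \<open>Because \<open>a = a * (1 - a) * (p + q) / p\<close> and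
    \<open>1 - a = a * (1 - a) * (p + q) / q\<close>, the divergence carries the same factor
    \<open>a * (1 - a)\<close> as the variance, and it cancels.\<close>
  also have "a * (1 / x * f x) + (1 - a) * (1 / y * f y)
      = a * (1 - a) * ((p + q) * (f x / x / p + f y / y / q))"
    unfolding a(3) unfolding a_def using pq xy
    by (simp add: divide_simps)
  finally have "a * (1 - a) * (\<alpha> * ((p + q) * (f x / x / p + f y / y / q)))
      \<le> a * (1 - a) * (deriv f y - deriv f x)\<^sup>2"
    by (simp add: mult_ac)
  then have "\<alpha> * ((p + q) * (f x / x / p + f y / y / q)) \<le> (deriv f y - deriv f x)\<^sup>2"
    by (rule mult_left_le_imp_le) (use a(1,2) in simp)
  moreover have "f x / (1 - x) = f x / x / p"
    using xy by (simp add: p_def field_simps)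
  moreover have "f y / (1 - y) = - (f y / y / q)"
    using xy by (simp add: q_def field_simps)
  ultimately show ?thesis
    unfolding diff(1) by (simp only: mult.assoc diff_minus_eq_add)
qed

text \<open>Independence of the constant from everything but \<open>f\<close> can be read in the
  given dimension or across all dimensions. Both readings hold: the forward direction yields one
  \<alpha> for every dimension, while a single dimension suffices for the converse.\<close>

theorem theorem4p3:
  fixes d :: nat and f :: "real \<Rightarrow> real"
  assumes "d \<ge> 1"
    and "C2_on_pos f"
    and "convex_on {0<..} f"
    and "f 1 = 0"
    and "deriv f 1 = 0"
  shows "(two_point_condition f \<longleftrightarrow> (\<exists>\<alpha>>0. gradient_dominance d f \<alpha>)) \<and>
         (two_point_condition f \<longleftrightarrow> (\<exists>\<alpha>>0. \<forall>d'\<ge>1. gradient_dominance d' f \<alpha>))"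
proof -
  have cont: "continuous_on {0<..} f" "continuous_on {0<..} (deriv f)"
    using assms(2) unfolding C2_on_pos_def
    by (auto intro!: continuous_at_imp_continuous_on differentiable_imp_continuous_within)
  \<comment> \<open>The tangent of \<open>f\<close> at 1 is the zero function, and a convex function
    lies above its tangents.\<close>
  have nonneg: "f x \<ge> 0" if "x > 0" for x
  proof -
    have "f differentiable (at 1)"
      using assms(2) by (simp add: C2_on_pos_def)
    then have "(f has_real_derivative 0) (at 1)"
      using assms(5) DERIV_deriv_iff_real_differentiable by metis
    then have "(f has_real_derivative 0) (at 1 within {0<..})"
      by (rule DERIV_subset) simp
    from convex_on_imp_above_tangent[OF assms(3) _ _ _ this, of x]
    show ?thesis using that assms(4) by (simp add: interior_open)
  qed
  have fwd: "\<exists>\<alpha>>0. \<forall>d'. gradient_dominance d' f \<alpha>" if "two_point_condition f"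
    using that gradient_dominance_of_two_point[OF _ _ assms(4) nonneg cont]
    unfolding two_point_condition_def by metis
  have bwd: "two_point_condition f" if "gradient_dominance d' f \<alpha>" "\<alpha> > 0" "d' \<ge> 1" for d' \<alpha>
    unfolding two_point_condition_def
    using two_point_of_gradient_dominance[OF that(1,3,2) nonneg cont] that(2) by blast
  show ?thesis
    using fwd bwd assms(1) by blast
qed

end
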